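(* Let $R$ be a commutative semiring. The functor $\mathrm{sSet}(-,-):\mathrm{sSet}^{op}\times \mathrm{sSet}\to \mathrm{Set}$ sending a pair $(X,Y)$ of simplicial sets to the set of simplicial set morphisms $X\to Y$ restricts to a functor $$\mathrm{sSet}(-,-):\mathrm{sSet}^{op}\times s\mathrm{Conv}_R\to \mathrm{Conv}_R,$$ where, for a simplicial set $X$ and a simplicial $R$-convex set $Y$, the set $\mathrm{sSet}(X,Y)$ is equipped with the structure map $\pi^{\mathrm{sSet}(X,Y)}:D_R(\mathrm{sSet}(X,Y))\to \mathrm{sSet}(X,Y)$ given by $\pi^{\mathrm{sSet}(X,Y)}=(\pi^Y)_*\circ\Theta_{X,Y}$. That is, $(\mathrm{sSet}(X,Y),\pi^{\mathrm{sSet}(X,Y)})$ is an $R$-convex set, and for every simplicial map $g:X_1\to X_2$ and every morphism $f:Y_1\to Y_2$ in $s\mathrm{Conv}_R$ the induced maps $g^*$ and $f_*$ are morphisms of $R$-convex sets.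
   Context: For a set $S$, $D_R(S)$ is the set of functions $p:S\to R$ of finite support with $\sum_{s}p(s)=1$; for $f:S\to T$, $D_R(f)(p)(t)=\sum_{f(s)=t}p(s)$. This is a monad on $\mathrm{Set}$ with unit $\delta_S(s)=\delta^s$ (the delta distribution at $s$) and multiplication $\mu_S(P)(s)=\sum_{p\in D_R(S)}P(p)p(s)$. An $R$-convex set is a $D_R$-algebra, i.e. a set $S$ with a map $\pi^S:D_R(S)\to S$ such that $\pi^S\circ\delta_S=\mathrm{Id}$ and $\pi^S\circ D_R(\pi^S)=\pi^S\circ\mu_S$; a morphism is a map $f:S\to T$ with $\pi^T\circ D_R(f)=f\circ\pi^S$. The category of $R$-convex sets is $\mathrm{Conv}_R$, and $s\mathrm{Conv}_R$ is the category of simplicial objects in $\mathrm{Conv}_R$; equivalently, of algebras in $\mathrm{sSet}$ over $D_R$ applied degreewise ($D_R(Y)_n=D_R(Y_n)$), so that a simplicial $R$-convex set $Y$ has a structure map $\pi^Y:D_R(Y)\to Y$ of simplicial sets. For simplicial sets $X,Y$ the map $\Theta_{X,Y}:D_R(\mathrm{sSet}(X,Y))\to \mathrm{sSet}(X,D_R(Y))$ is defined by $\Theta_{X,Y}(d)_n(x)=\sum_{\varphi\in\mathrm{sSet}(X,Y)}d(\varphi)\,\delta^{\varphi_n(x)}$ for $x\in X_n$. *)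

theory Defs
  imports "HOL-Library.FuncSet"
begin

section \<open>The distribution monad\<close>

text \<open>
  The commutative semiring $R$ is a type of sort \<open>{comm_semiring_0, comm_monoid_mult}\<close>.
  This is \<open>comm_semiring_1\<close> without the axiom \<open>0 \<noteq> 1\<close>, so the zero semiring is included.

  A finitely supported function $S \to R$ is represented by its extension by zero to the
  whole type; its support is then contained in \<open>S\<close>.  Sums over all of \<open>S\<close> are
  written as sums over the support, since \<open>sum\<close> returns 0 on infinite index sets.
\<close>

definition Dset :: "'a set \<Rightarrow> ('a \<Rightarrow> 'r::{comm_semiring_0, comm_monoid_mult}) set" where
  "Dset S = {p. finite {s. p s \<noteq> 0} \<and> {s. p s \<noteq> 0} \<subseteq> S \<and> (\<Sum>s | p s \<noteq> 0. p s) = 1}"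

definition Dmap ::
    "('a \<Rightarrow> 'b) \<Rightarrow> ('a \<Rightarrow> 'r::{comm_semiring_0, comm_monoid_mult}) \<Rightarrow> 'b \<Rightarrow> 'r" where
  "Dmap f p = (\<lambda>t. \<Sum>s | p s \<noteq> 0 \<and> f s = t. p s)"

definition delta :: "'a \<Rightarrow> 'a \<Rightarrow> 'r::{comm_semiring_0, comm_monoid_mult}" where
  "delta s = (\<lambda>t. if t = s then 1 else 0)"

definition Dmult ::
    "(('a \<Rightarrow> 'r::{comm_semiring_0, comm_monoid_mult}) \<Rightarrow> 'r) \<Rightarrow> 'a \<Rightarrow> 'r" where
  "Dmult P = (\<lambda>s. \<Sum>p | P p \<noteq> 0. P p * p s)"


section \<open>Convex sets\<close>

text \<open>
  Structure maps and morphisms of convex sets are functions on the whole type of which only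
  the values on \<open>Dset S\<close>, respectively \<open>S\<close>, matter.
\<close>

definition convex_set ::
    "'a set \<Rightarrow> (('a \<Rightarrow> 'r::{comm_semiring_0, comm_monoid_mult}) \<Rightarrow> 'a) \<Rightarrow> bool" where
  "convex_set S \<pi> \<longleftrightarrow>
     \<pi> \<in> Dset S \<rightarrow> S \<and>
     (\<forall>s\<in>S. \<pi> (delta s) = s) \<and>
     (\<forall>P\<in>Dset (Dset S). \<pi> (Dmap \<pi> P) = \<pi> (Dmult P))"

definition convex_morphism ::
    "'a set \<Rightarrow> (('a \<Rightarrow> 'r::{comm_semiring_0, comm_monoid_mult}) \<Rightarrow> 'a) \<Rightarrow>
     'b set \<Rightarrow> (('b \<Rightarrow> 'r) \<Rightarrow> 'b) \<Rightarrow> ('a \<Rightarrow> 'b) \<Rightarrow> bool" where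
  "convex_morphism S \<pi> T \<rho> f \<longleftrightarrow>
     f \<in> S \<rightarrow> T \<and> (\<forall>p\<in>Dset S. \<rho> (Dmap f p) = f (\<pi> p))"


section \<open>Simplicial sets\<close>

text \<open>
  \<open>Delta m n\<close> is the set of monotone maps $[m] \to [n]$, where $[n] = \{0, \ldots, n\}$.
  A simplicial set is a contravariant functor on the category with these morphisms:
  \<open>act X m n \<theta>\<close> is the map $X_n \to X_m$ induced by $\theta : [m] \to [n]$.
\<close>

definition Delta :: "nat \<Rightarrow> nat \<Rightarrow> (nat \<Rightarrow> nat) set" where
  "Delta m n = {\<theta> \<in> {..m} \<rightarrow>\<^sub>E {..n}. mono_on {..m} \<theta>}"

record 'a sset =
  cells :: "nat \<Rightarrow> 'a set"
  act :: "nat \<Rightarrow> nat \<Rightarrow> (nat \<Rightarrow> nat) \<Rightarrow> 'a \<Rightarrow> 'a"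

definition simplicial_set :: "('a, 'z) sset_scheme \<Rightarrow> bool" where
  "simplicial_set X \<longleftrightarrow>
     (\<forall>m n. \<forall>\<theta>\<in>Delta m n. act X m n \<theta> \<in> cells X n \<rightarrow> cells X m) \<and>
     (\<forall>n. \<forall>x\<in>cells X n. act X n n (\<lambda>i\<in>{..n}. i) x = x) \<and>
     (\<forall>k m n. \<forall>\<eta>\<in>Delta k m. \<forall>\<theta>\<in>Delta m n. \<forall>x\<in>cells X n.
        act X k n (compose {..k} \<theta> \<eta>) x = act X k m \<eta> (act X m n \<theta> x))"

text \<open>
  The set of simplicial maps $X \to Y$.  The components are extensional functions, so that
  equality in this set is equality of simplicial maps.
\<close>

definition sSet ::
    "('a, 'z) sset_scheme \<Rightarrow> ('b, 'w) sset_scheme \<Rightarrow> (nat \<Rightarrow> 'a \<Rightarrow> 'b) set" where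
  "sSet X Y = {f. (\<forall>n. f n \<in> cells X n \<rightarrow>\<^sub>E cells Y n) \<and>
     (\<forall>m n. \<forall>\<theta>\<in>Delta m n. \<forall>x\<in>cells X n. f m (act X m n \<theta> x) = act Y m n \<theta> (f n x))}"

definition sset_id :: "('a, 'z) sset_scheme \<Rightarrow> nat \<Rightarrow> 'a \<Rightarrow> 'a" where
  "sset_id X = (\<lambda>n. \<lambda>x\<in>cells X n. x)"

text \<open>The composite $g \circ f$, where \<open>X\<close> is the domain of \<open>f\<close>.\<close>

definition sset_comp ::
    "('a, 'z) sset_scheme \<Rightarrow> (nat \<Rightarrow> 'b \<Rightarrow> 'c) \<Rightarrow> (nat \<Rightarrow> 'a \<Rightarrow> 'b) \<Rightarrow> nat \<Rightarrow> 'a \<Rightarrow> 'c" where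
  "sset_comp X g f = (\<lambda>n. compose (cells X n) (g n) (f n))"

text \<open>
  For $g : X_1 \to X_2$ and $f : Y_1 \to Y_2$, the maps
  $g^* : \mathrm{sSet}(X_2,Y) \to \mathrm{sSet}(X_1,Y)$ and
  $f_* : \mathrm{sSet}(X,Y_1) \to \mathrm{sSet}(X,Y_2)$, and the action
  $\mathrm{sSet}(g,f) : \mathrm{sSet}(X_2,Y_1) \to \mathrm{sSet}(X_1,Y_2)$ of the hom-functor.
  The first argument is \<open>X\<^sub>1\<close>, \<open>X\<close> and \<open>X\<^sub>1\<close>, respectively.
\<close>

definition pullback ::
    "('a, 'z) sset_scheme \<Rightarrow> (nat \<Rightarrow> 'a \<Rightarrow> 'b) \<Rightarrow> (nat \<Rightarrow> 'b \<Rightarrow> 'c) \<Rightarrow> nat \<Rightarrow> 'a \<Rightarrow> 'c" where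
  "pullback X1 g \<phi> = sset_comp X1 \<phi> g"

definition pushforward ::
    "('a, 'z) sset_scheme \<Rightarrow> (nat \<Rightarrow> 'b \<Rightarrow> 'c) \<Rightarrow> (nat \<Rightarrow> 'a \<Rightarrow> 'b) \<Rightarrow> nat \<Rightarrow> 'a \<Rightarrow> 'c" where
  "pushforward X f \<phi> = sset_comp X f \<phi>"

definition sSet_map ::
    "('a, 'z) sset_scheme \<Rightarrow> (nat \<Rightarrow> 'a \<Rightarrow> 'b) \<Rightarrow> (nat \<Rightarrow> 'c \<Rightarrow> 'd) \<Rightarrow>
     (nat \<Rightarrow> 'b \<Rightarrow> 'c) \<Rightarrow> nat \<Rightarrow> 'a \<Rightarrow> 'd" where
  "sSet_map X1 g f \<phi> = pushforward X1 f (pullback X1 g \<phi>)"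


section \<open>Simplicial convex sets\<close>

text \<open>\<open>str Y n\<close> is the structure map \<open>Dset (cells Y n) \<rightarrow> cells Y n\<close>.\<close>

record ('a, 'r) sconv = "'a sset" +
  str :: "nat \<Rightarrow> ('a \<Rightarrow> 'r) \<Rightarrow> 'a"

definition simplicial_convex_set ::
    "('a, 'r::{comm_semiring_0, comm_monoid_mult}) sconv \<Rightarrow> bool" where
  "simplicial_convex_set Y \<longleftrightarrow>
     simplicial_set Y \<and>
     (\<forall>n. convex_set (cells Y n) (str Y n)) \<and>
     (\<forall>m n. \<forall>\<theta>\<in>Delta m n.
        convex_morphism (cells Y n) (str Y n) (cells Y m) (str Y m) (act Y m n \<theta>))"

definition sConv ::
    "('a, 'r::{comm_semiring_0, comm_monoid_mult}) sconv \<Rightarrow> ('b, 'r) sconv \<Rightarrow>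
     (nat \<Rightarrow> 'a \<Rightarrow> 'b) set" where
  "sConv Y Z = {f \<in> sSet Y Z.
     \<forall>n. convex_morphism (cells Y n) (str Y n) (cells Z n) (str Z n) (f n)}"

definition Theta ::
    "('a, 'z) sset_scheme \<Rightarrow> ('b, 'w) sset_scheme \<Rightarrow>
     ((nat \<Rightarrow> 'a \<Rightarrow> 'b) \<Rightarrow> 'r::{comm_semiring_0, comm_monoid_mult}) \<Rightarrow>
     nat \<Rightarrow> 'a \<Rightarrow> 'b \<Rightarrow> 'r" where
  "Theta X Y d = (\<lambda>n. \<lambda>x\<in>cells X n. \<lambda>y. \<Sum>\<phi> | d \<phi> \<noteq> 0. d \<phi> * delta (\<phi> n x) y)"

definition hom_str ::
    "('a, 'z) sset_scheme \<Rightarrow> ('b, 'r::{comm_semiring_0, comm_monoid_mult}) sconv \<Rightarrow>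
     ((nat \<Rightarrow> 'a \<Rightarrow> 'b) \<Rightarrow> 'r) \<Rightarrow> nat \<Rightarrow> 'a \<Rightarrow> 'b" where
  "hom_str X Y = pushforward X (str Y) \<circ> Theta X Y"

end

(*
  Theta sends a distribution d on sSet(X, Y) to the family of its pushforwards along the evaluation
  maps ev_{n,x} : phi |-> phi_n(x).  So the structure map on sSet(X, Y) is the unique one making all
  evaluations morphisms of convex sets, and as the evaluations are jointly injective, every
  required equation can be checked after evaluation, where it reduces to functoriality of D_R, to
  naturality of its unit and multiplication, or to an axiom for Y.
*)
theory Submission imports Defs begin

section \<open>The distribution monad\<close>

lemma Dset_finite: "p \<in> Dset S \<Longrightarrow> finite {s. p s \<noteq> 0}"
  by (simp add: Dset_def)

lemma Dset_supp: "p \<in> Dset S \<Longrightarrow> p s \<noteq> 0 \<Longrightarrow> s \<in> S"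
  by (auto simp: Dset_def)

text \<open>In a semiring nonzero terms may sum to zero, so the exact support of a function built
  from sums is out of reach. Normalisation is therefore checked over a finite superset
  \<open>A\<close> of the support.\<close>

lemma Dset_intro:
  assumes "finite A" "A \<subseteq> S" "\<And>s. p s \<noteq> 0 \<Longrightarrow> s \<in> A" "sum p A = 1"
  shows "p \<in> Dset S"
proof -
  have "(\<Sum>s | p s \<noteq> 0. p s) = sum p A"
    using assms by (intro sum.mono_neutral_left) auto
  moreover have "{s. p s \<noteq> 0} \<subseteq> A"
    using assms by auto
  ultimately show ?thesis
    using assms finite_subset[of "{s. p s \<noteq> 0}" A] by (auto simp: Dset_def)
qed

section \<open>Pushforward of distributions and the unit\<close>

text \<open>The index set no longer depends on \<open>f\<close> or \<open>t\<close>: the fibre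
  condition moves into the summand, which is what exchanging double sums requires.\<close>

lemma Dmap_eq_sum:
  assumes "finite A" "\<And>s. p s \<noteq> 0 \<Longrightarrow> s \<in> A"
  shows "Dmap f p t = (\<Sum>s\<in>A. if f s = t then p s else 0)"
proof -
  have "Dmap f p t = (\<Sum>s\<in>{s\<in>A. f s = t}. p s)"
    unfolding Dmap_def using assms by (intro sum.mono_neutral_left) auto
  also have "\<dots> = (\<Sum>s\<in>A. if f s = t then p s else 0)"
    using assms(1) by (rule sum.inter_filter)
  finally show ?thesis .
qed

lemma Dmap_supp: "Dmap f p t \<noteq> 0 \<Longrightarrow> t \<in> f ` {s. p s \<noteq> 0}"
  unfolding Dmap_def by (erule sum.not_neutral_contains_not_neutral) auto

lemma Dmap_in_Dset:
  assumes p: "p \<in> Dset S" and f: "f \<in> S \<rightarrow> T"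
  shows "Dmap f p \<in> Dset T"
proof (rule Dset_intro)
  let ?A = "{s. p s \<noteq> 0}"
  show fin: "finite (f ` ?A)" using Dset_finite[OF p] by simp
  show "f ` ?A \<subseteq> T" using Dset_supp[OF p] f by auto
  show "t \<in> f ` ?A" if "Dmap f p t \<noteq> 0" for t
    using that by (rule Dmap_supp)
  have "sum (Dmap f p) (f ` ?A) = (\<Sum>t\<in>f ` ?A. \<Sum>s\<in>{s\<in>?A. f s = t}. p s)"
    by (simp add: Dmap_def)
  also have "\<dots> = sum p ?A"
    using Dset_finite[OF p] by (rule sum.image_gen[symmetric])
  also have "\<dots> = 1" using p by (simp add: Dset_def)
  finally show "sum (Dmap f p) (f ` ?A) = 1" .
qed

text \<open>Naturality squares and the formula for the structure map on simplicial maps hold only on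
  a carrier set, which contains the support; this lets them be used under
  \<open>Dmap\<close>.\<close>

lemma Dmap_cong:
  assumes "p \<in> Dset S" "\<And>s. s \<in> S \<Longrightarrow> f s = g s"
  shows "Dmap f p = Dmap g p"
proof -
  have "{s. p s \<noteq> 0 \<and> f s = t} = {s. p s \<noteq> 0 \<and> g s = t}" for t
    using assms Dset_supp[OF assms(1)] by metis
  then show ?thesis
    by (simp add: Dmap_def)
qed

lemma Dmap_comp:
  assumes "finite {s. p s \<noteq> 0}"
  shows "Dmap g (Dmap f p) = Dmap (\<lambda>s. g (f s)) p"
proof
  fix u
  let ?A = "{s. p s \<noteq> 0}"
  have "Dmap g (Dmap f p) u = (\<Sum>t\<in>f ` ?A. if g t = u then Dmap f p t else 0)"
    using assms by (intro Dmap_eq_sum) (auto dest: Dmap_supp)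
  \<comment> \<open>Under \<open>f s = t\<close> the test \<open>g t = u\<close> becomes
    \<open>g (f s) = u\<close>. After the swap, the inner sum over \<open>t\<close> has only the
    term \<open>t = f s\<close>.\<close>
  also have "\<dots> = (\<Sum>t\<in>f ` ?A. \<Sum>s\<in>?A. if f s = t then (if g (f s) = u then p s else 0) else 0)"
    using assms by (intro sum.cong refl) (auto simp: Dmap_eq_sum[of ?A] intro!: sum.cong sum.neutral)
  also have "\<dots> = (\<Sum>s\<in>?A. \<Sum>t\<in>f ` ?A. if f s = t then (if g (f s) = u then p s else 0) else 0)"
    by (rule sum.swap)
  also have "\<dots> = (\<Sum>s\<in>?A. if g (f s) = u then p s else 0)"
    using assms by (intro sum.cong refl) (simp add: sum.delta)
  also have "\<dots> = Dmap (\<lambda>s. g (f s)) p u"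
    using assms by (intro Dmap_eq_sum[symmetric]) auto
  finally show "Dmap g (Dmap f p) u = Dmap (\<lambda>s. g (f s)) p u" .
qed

lemma Dmap_delta: "Dmap f (delta s) = delta (f s)"
proof
  fix t
  have "Dmap f (delta s) t = (\<Sum>u\<in>{s}. if f u = t then delta s u else 0)"
    by (rule Dmap_eq_sum) (auto simp: delta_def split: if_splits)
  then show "Dmap f (delta s) t = delta (f s) t"
    by (auto simp: delta_def)
qed

lemma delta_in_Dset: "s \<in> S \<Longrightarrow> delta s \<in> Dset S"
  by (rule Dset_intro[of "{s}"]) (auto simp: delta_def split: if_splits)

section \<open>Multiplication of the monad\<close>

lemma Dmult_eq_sum:
  assumes "finite A" "\<And>p. P p \<noteq> 0 \<Longrightarrow> p \<in> A"
  shows "Dmult P s = (\<Sum>p\<in>A. P p * p s)"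
  unfolding Dmult_def using assms by (intro sum.mono_neutral_left) auto

text \<open>The union of the finitely many finite supports occurring in \<open>P\<close> works. It
  provides one finite index set for all inner distributions, so that sums over points and over
  distributions can be exchanged.\<close>

lemma Dset_Dset_common_support:
  assumes "P \<in> Dset (Dset S)"
  obtains A where "finite A" "A \<subseteq> S" "\<And>p s. P p \<noteq> 0 \<Longrightarrow> p s \<noteq> 0 \<Longrightarrow> s \<in> A"
proof (rule that)
  let ?A = "\<Union>p\<in>{p. P p \<noteq> 0}. {s. p s \<noteq> 0}"
  show "finite ?A"
    using assms by (auto intro: Dset_finite dest: Dset_supp)
  show "?A \<subseteq> S"
    using assms by (auto dest!: Dset_supp)
  show "s \<in> ?A" if "P p \<noteq> 0" "p s \<noteq> 0" for p s
    using that by auto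
qed

lemma Dmult_supp: "Dmult P s \<noteq> 0 \<Longrightarrow> \<exists>p. P p \<noteq> 0 \<and> p s \<noteq> 0"
  unfolding Dmult_def by (erule sum.not_neutral_contains_not_neutral) auto

lemma Dset_sum_eq_1:
  assumes "p \<in> Dset S" "finite A" "\<And>s. p s \<noteq> 0 \<Longrightarrow> s \<in> A"
  shows "sum p A = 1"
proof -
  have "sum p A = (\<Sum>s | p s \<noteq> 0. p s)"
    using assms by (intro sum.mono_neutral_right) auto
  then show ?thesis using assms by (simp add: Dset_def)
qed

text \<open>After exchanging sums, the mass of the mixture is the \<open>P\<close>-weighted sum of
  the masses of its components; these are all 1, which leaves the mass of \<open>P\<close>.\<close>

lemma Dmult_in_Dset:
  assumes P: "P \<in> Dset (Dset S)"
  shows "Dmult P \<in> Dset S"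
proof -
  obtain A where A: "finite A" "A \<subseteq> S" "\<And>p s. P p \<noteq> 0 \<Longrightarrow> p s \<noteq> 0 \<Longrightarrow> s \<in> A"
    using Dset_Dset_common_support[OF P] by blast
  show ?thesis
  proof (rule Dset_intro[OF A(1,2)])
    show "s \<in> A" if "Dmult P s \<noteq> 0" for s
      using Dmult_supp[OF that] by (auto intro: A(3))
    have "sum (Dmult P) A = (\<Sum>p | P p \<noteq> 0. P p * sum p A)"
      unfolding Dmult_def by (subst sum.swap) (simp add: sum_distrib_left)
    also have "\<dots> = (\<Sum>p | P p \<noteq> 0. P p)"
    proof (intro sum.cong refl)
      fix p assume p: "p \<in> {p. P p \<noteq> 0}"
      then have "p \<in> Dset S" using Dset_supp[OF P] by simp
      then have "sum p A = 1" using A p by (intro Dset_sum_eq_1) auto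
      then show "P p * sum p A = P p" by simp
    qed
    also have "\<dots> = 1" using P by (simp add: Dset_def)
    finally show "sum (Dmult P) A = 1" .
  qed
qed

text \<open>Naturality of the multiplication. Both sides equal the sum of
  \<open>P p * Dmap f p t\<close> over the support of \<open>P\<close>: on the left by linearity of
  pushforward, on the right by grouping the \<open>p\<close> according to
  \<open>Dmap f p\<close>.\<close>

lemma Dmap_Dmult:
  assumes P: "P \<in> Dset (Dset S)"
  shows "Dmap f (Dmult P) = Dmult (Dmap (Dmap f) P)"
proof
  fix t
  let ?B = "{p. P p \<noteq> 0}"
  obtain A where A: "finite A" "A \<subseteq> S" "\<And>p s. P p \<noteq> 0 \<Longrightarrow> p s \<noteq> 0 \<Longrightarrow> s \<in> A"
    using Dset_Dset_common_support[OF P] by blast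
  have B: "finite ?B" using P by (rule Dset_finite)
  have "Dmap f (Dmult P) t = (\<Sum>s\<in>A. if f s = t then Dmult P s else 0)"
    by (rule Dmap_eq_sum[OF A(1)]) (auto dest!: Dmult_supp intro: A(3))
  also have "\<dots> = (\<Sum>s\<in>A. \<Sum>p\<in>?B. P p * (if f s = t then p s else 0))"
    by (intro sum.cong refl) (simp add: Dmult_def)
  also have "\<dots> = (\<Sum>p\<in>?B. P p * (\<Sum>s\<in>A. if f s = t then p s else 0))"
    unfolding sum_distrib_left by (rule sum.swap)
  also have "\<dots> = (\<Sum>p\<in>?B. P p * Dmap f p t)"
  proof (intro sum.cong refl)
    fix p assume "p \<in> ?B"
    then have "Dmap f p t = (\<Sum>s\<in>A. if f s = t then p s else 0)"
      by (intro Dmap_eq_sum[OF A(1)]) (simp add: A(3))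
    then show "P p * (\<Sum>s\<in>A. if f s = t then p s else 0) = P p * Dmap f p t"
      by simp
  qed
  \<comment> \<open>Each \<open>p\<close> contributes at the single index
    \<open>q = Dmap f p\<close>. Swapping the sums then collects all \<open>p\<close> with the same
    pushforward, whose weights add up to \<open>Dmap (Dmap f) P q\<close>.\<close>
  also have "\<dots> = (\<Sum>p\<in>?B. \<Sum>q\<in>Dmap f ` ?B. if Dmap f p = q then P p * q t else 0)"
    using B by (intro sum.cong refl) (simp add: sum.delta)
  also have "\<dots> = (\<Sum>q\<in>Dmap f ` ?B. \<Sum>p\<in>?B. if Dmap f p = q then P p * q t else 0)"
    by (rule sum.swap)
  also have "\<dots> = (\<Sum>q\<in>Dmap f ` ?B. Dmap (Dmap f) P q * q t)"
  proof (intro sum.cong refl)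
    fix q
    have "Dmap (Dmap f) P q = (\<Sum>p\<in>?B. if Dmap f p = q then P p else 0)"
      by (rule Dmap_eq_sum[OF B]) simp
    then show "(\<Sum>p\<in>?B. if Dmap f p = q then P p * q t else 0) = Dmap (Dmap f) P q * q t"
      by (simp add: sum_distrib_right if_distrib[of "\<lambda>r. r * q t"] cong: if_cong)
  qed
  also have "\<dots> = Dmult (Dmap (Dmap f) P) t"
    by (rule Dmult_eq_sum[symmetric, OF finite_imageI[OF B] Dmap_supp])
  finally show "Dmap f (Dmult P) t = Dmult (Dmap (Dmap f) P) t" .
qed

text \<open>Pushing forward along a composite is pushing forward twice, so the two morphism
  conditions chain. This reduces the joint action of the hom-functor to one variable at a
  time.\<close>

lemma convex_morphism_comp:
  fixes \<pi> :: "('a \<Rightarrow> 'r::{comm_semiring_0, comm_monoid_mult}) \<Rightarrow> 'a"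
  assumes f: "convex_morphism S \<pi> T \<rho> f" and g: "convex_morphism T \<rho> U \<sigma> g"
  shows "convex_morphism S \<pi> U \<sigma> (\<lambda>s. g (f s))"
  unfolding convex_morphism_def
proof (intro conjI ballI)
  show "(\<lambda>s. g (f s)) \<in> S \<rightarrow> U"
    using f g by (auto simp: convex_morphism_def)
  fix p :: "'a \<Rightarrow> 'r" assume p: "p \<in> Dset S"
  then have "Dmap f p \<in> Dset T"
    using f by (intro Dmap_in_Dset) (auto simp: convex_morphism_def)
  then show "\<sigma> (Dmap (\<lambda>s. g (f s)) p) = g (f (\<pi> p))"
    using f g p by (simp add: convex_morphism_def Dmap_comp[symmetric] Dset_finite)
qed


section \<open>Simplicial maps\<close>

lemma sSet_in: "f \<in> sSet X Y \<Longrightarrow> x \<in> cells X n \<Longrightarrow> f n x \<in> cells Y n"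
  by (auto simp: sSet_def)

lemma sSet_outside: "f \<in> sSet X Y \<Longrightarrow> x \<notin> cells X n \<Longrightarrow> f n x = undefined"
  unfolding sSet_def by (blast intro: PiE_arb)

lemma sSet_act:
  "f \<in> sSet X Y \<Longrightarrow> \<theta> \<in> Delta m n \<Longrightarrow> x \<in> cells X n \<Longrightarrow> f m (act X m n \<theta> x) = act Y m n \<theta> (f n x)"
  by (simp add: sSet_def)

lemma act_in:
  "simplicial_set X \<Longrightarrow> \<theta> \<in> Delta m n \<Longrightarrow> x \<in> cells X n \<Longrightarrow> act X m n \<theta> x \<in> cells X m"
  unfolding simplicial_set_def by blast

lemma sSet_comp_in:
  assumes "simplicial_set X" "f \<in> sSet X Y" "g \<in> sSet Y Z"
  shows "sset_comp X g f \<in> sSet X Z"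
  using assms
  by (auto simp: sSet_def[of X Z] sset_comp_def compose_def act_in sSet_in sSet_act)

lemma sConv_sSet: "f \<in> sConv Y Z \<Longrightarrow> f \<in> sSet Y Z"
  by (simp add: sConv_def)


section \<open>The convex structure on the set of simplicial maps\<close>

text \<open>The coefficient of \<open>Theta X Y d n x\<close> at \<open>y\<close> collects the
  weights of all \<open>\<phi>\<close> with \<open>\<phi> n x = y\<close>, hence is that of the
  pushforward of \<open>d\<close> along evaluation. The value \<open>undefined\<close> off the cells
  comes from the extensional composition in \<open>pushforward\<close>.\<close>

lemma hom_str_eq:
  assumes "d \<in> Dset S"
  shows "hom_str X Y d n x =
     (if x \<in> cells X n then str Y n (Dmap (\<lambda>\<phi>. \<phi> n x) d) else undefined)"
proof -
  have "(\<Sum>\<phi> | d \<phi> \<noteq> 0. d \<phi> * delta (\<phi> n x) y) = Dmap (\<lambda>\<phi>. \<phi> n x) d y" for y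
    using Dset_finite[OF assms]
    by (auto simp: Dmap_eq_sum[of "{\<phi>. d \<phi> \<noteq> 0}"] delta_def intro!: sum.cong)
  then show ?thesis
    by (simp add: hom_str_def pushforward_def sset_comp_def compose_def Theta_def)
qed

lemma eval_in: "x \<in> cells X n \<Longrightarrow> (\<lambda>\<phi>. \<phi> n x) \<in> sSet X Y \<rightarrow> cells Y n"
  by (simp add: sSet_in)

lemma str_in: "simplicial_convex_set Y \<Longrightarrow> p \<in> Dset (cells Y n) \<Longrightarrow> str Y n p \<in> cells Y n"
  by (auto simp: simplicial_convex_set_def convex_set_def)

text \<open>Compatibility with \<open>\<theta>\<close> combines two facts: the maps in the support
  of \<open>d\<close> are natural, so \<open>act Y m n \<theta>\<close> can be pulled out of the
  evaluation, and it is a convex morphism, so it passes through the structure map.\<close>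

lemma hom_str_in:
  assumes X: "simplicial_set X" and Y: "simplicial_convex_set Y" and d: "d \<in> Dset (sSet X Y)"
  shows "hom_str X Y d \<in> sSet X Y"
  unfolding sSet_def mem_Collect_eq
proof (intro conjI allI ballI)
  show "hom_str X Y d n \<in> cells X n \<rightarrow>\<^sub>E cells Y n" for n
    using Y d by (auto simp: hom_str_eq[OF d] intro!: str_in Dmap_in_Dset eval_in)
  fix m n \<theta> x assume \<theta>: "\<theta> \<in> Delta m n" and x: "x \<in> cells X n"
  have "Dmap (\<lambda>\<phi>. \<phi> m (act X m n \<theta> x)) d = Dmap (\<lambda>\<phi>. act Y m n \<theta> (\<phi> n x)) d"
    using d \<theta> x by (intro Dmap_cong) (auto simp: sSet_act)
  also have "\<dots> = Dmap (act Y m n \<theta>) (Dmap (\<lambda>\<phi>. \<phi> n x) d)"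
    using d by (simp add: Dmap_comp Dset_finite)
  finally have "str Y m (Dmap (\<lambda>\<phi>. \<phi> m (act X m n \<theta> x)) d) =
      act Y m n \<theta> (str Y n (Dmap (\<lambda>\<phi>. \<phi> n x) d))"
    using Y \<theta> Dmap_in_Dset[OF d eval_in[OF x]]
    by (simp add: simplicial_convex_set_def convex_morphism_def)
  then show "hom_str X Y d m (act X m n \<theta> x) = act Y m n \<theta> (hom_str X Y d n x)"
    using X \<theta> x by (simp add: hom_str_eq[OF d] act_in)
qed

lemma convex_set_sSet:
  fixes X :: "('a, 'z) sset_scheme" and Y :: "('b, 'r::{comm_semiring_0, comm_monoid_mult}) sconv"
  assumes X: "simplicial_set X" and Y: "simplicial_convex_set Y"
  shows "convex_set (sSet X Y) (hom_str X Y)"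
  unfolding convex_set_def
proof (intro conjI ballI)
  show hom: "hom_str X Y \<in> Dset (sSet X Y) \<rightarrow> sSet X Y"
    using X Y by (auto intro: hom_str_in)
  show "hom_str X Y (delta \<phi>) = \<phi>" if \<phi>: "\<phi> \<in> sSet X Y" for \<phi>
  proof (intro ext)
    fix n x
    \<comment> \<open>On cells this is the unit law of \<open>Y\<close> in degree \<open>n\<close>
      at the point \<open>\<phi> n x\<close>; elsewhere both sides are
      \<open>undefined\<close>.\<close>
    show "hom_str X Y (delta \<phi>) n x = \<phi> n x"
      using Y sSet_in[OF \<phi>] sSet_outside[OF \<phi>]
      by (simp add: hom_str_eq[OF delta_in_Dset[OF \<phi>]] Dmap_delta
          simplicial_convex_set_def convex_set_def)
  qed
  fix P :: "((nat \<Rightarrow> 'a \<Rightarrow> 'b) \<Rightarrow> 'r) \<Rightarrow> 'r"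
  assume P: "P \<in> Dset (Dset (sSet X Y))"
  show "hom_str X Y (Dmap (hom_str X Y) P) = hom_str X Y (Dmult P)"
  proof (intro ext)
    fix n x
    show "hom_str X Y (Dmap (hom_str X Y) P) n x = hom_str X Y (Dmult P) n x"
    proof (cases "x \<in> cells X n")
      case x: True
      let ?ev = "\<lambda>\<phi>. \<phi> n x"
      \<comment> \<open>This places the twice evaluated \<open>P\<close> where the associativity law
        of \<open>Y\<close> in degree \<open>n\<close> applies.\<close>
      have evP: "Dmap (Dmap ?ev) P \<in> Dset (Dset (cells Y n))"
        by (intro Dmap_in_Dset[OF P] funcsetI) (rule Dmap_in_Dset[OF _ eval_in[OF x]])
      have "Dmap ?ev (Dmap (hom_str X Y) P) = Dmap (\<lambda>d. hom_str X Y d n x) P"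
        using P by (simp add: Dmap_comp Dset_finite)
      \<comment> \<open>The pointwise formula for \<open>hom_str\<close> is available at
        distributions \<open>d\<close> only, and \<open>P\<close> is supported on these.\<close>
      also have "\<dots> = Dmap (\<lambda>d. str Y n (Dmap ?ev d)) P"
        using P x by (intro Dmap_cong) (auto simp: hom_str_eq)
      also have "\<dots> = Dmap (str Y n) (Dmap (Dmap ?ev) P)"
        using P by (simp add: Dmap_comp Dset_finite)
      finally have "str Y n (Dmap ?ev (Dmap (hom_str X Y) P)) =
          str Y n (Dmult (Dmap (Dmap ?ev) P))"
        using Y evP by (simp add: simplicial_convex_set_def convex_set_def)
      also have "\<dots> = str Y n (Dmap ?ev (Dmult P))"
        using P by (simp add: Dmap_Dmult)
      finally show ?thesis
        using x by (simp add: hom_str_eq[OF Dmap_in_Dset[OF P hom]] hom_str_eq[OF Dmult_in_Dset[OF P]])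
    qed (simp add: hom_str_eq[OF Dmap_in_Dset[OF P hom]] hom_str_eq[OF Dmult_in_Dset[OF P]])
  qed
qed

section \<open>Induced maps and functor laws\<close>

text \<open>Evaluating a pullback along \<open>g\<close> at \<open>x\<close> is evaluating the
  original map at \<open>g n x\<close>. Both sides therefore apply \<open>str Y n\<close> to the
  same distribution.\<close>

lemma convex_morphism_pullback:
  fixes X1 :: "('a, 'z) sset_scheme" and X2 :: "('b, 'w) sset_scheme"
    and Y :: "('c, 'r::{comm_semiring_0, comm_monoid_mult}) sconv"
  assumes X1: "simplicial_set X1" and g: "g \<in> sSet X1 X2"
  shows "convex_morphism (sSet X2 Y) (hom_str X2 Y) (sSet X1 Y) (hom_str X1 Y) (pullback X1 g)"
  unfolding convex_morphism_def
proof (intro conjI ballI)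
  show pb: "pullback X1 g \<in> sSet X2 Y \<rightarrow> sSet X1 Y"
    using X1 g by (auto simp: pullback_def intro: sSet_comp_in)
  fix d :: "(nat \<Rightarrow> 'b \<Rightarrow> 'c) \<Rightarrow> 'r"
  assume d: "d \<in> Dset (sSet X2 Y)"
  have "Dmap (\<lambda>\<phi>. \<phi> n x) (Dmap (pullback X1 g) d) = Dmap (\<lambda>\<phi>. \<phi> n (g n x)) d"
    if "x \<in> cells X1 n" for n x
    using d that by (simp add: Dmap_comp Dset_finite pullback_def sset_comp_def compose_def)
  then show "hom_str X1 Y (Dmap (pullback X1 g) d) = pullback X1 g (hom_str X2 Y d)"
    using sSet_in[OF g]
    by (intro ext) (simp add: hom_str_eq[OF Dmap_in_Dset[OF d pb]] hom_str_eq[OF d]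
        pullback_def sset_comp_def compose_def)
qed

text \<open>Evaluation at \<open>x\<close> after postcomposition with \<open>f\<close> is
  \<open>f n\<close> after evaluation at \<open>x\<close>, and \<open>f n\<close> passes through the
  structure maps because it is a convex morphism.\<close>

lemma convex_morphism_pushforward:
  fixes X :: "('a, 'z) sset_scheme" and Y1 :: "('b, 'r::{comm_semiring_0, comm_monoid_mult}) sconv" and Y2 :: "('c, 'r) sconv"
  assumes X: "simplicial_set X" and f: "f \<in> sConv Y1 Y2"
  shows "convex_morphism (sSet X Y1) (hom_str X Y1) (sSet X Y2) (hom_str X Y2) (pushforward X f)"
  unfolding convex_morphism_def
proof (intro conjI ballI)
  show pf: "pushforward X f \<in> sSet X Y1 \<rightarrow> sSet X Y2"
    using X sConv_sSet[OF f] by (auto simp: pushforward_def intro: sSet_comp_in)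
  fix d :: "(nat \<Rightarrow> 'a \<Rightarrow> 'b) \<Rightarrow> 'r"
  assume d: "d \<in> Dset (sSet X Y1)"
  have "str Y2 n (Dmap (\<lambda>\<phi>. \<phi> n x) (Dmap (pushforward X f) d)) =
      f n (str Y1 n (Dmap (\<lambda>\<phi>. \<phi> n x) d))" if x: "x \<in> cells X n" for n x
  proof -
    have "Dmap (\<lambda>\<phi>. \<phi> n x) (Dmap (pushforward X f) d) = Dmap (f n) (Dmap (\<lambda>\<phi>. \<phi> n x) d)"
      using d x by (simp add: Dmap_comp Dset_finite pushforward_def sset_comp_def compose_def)
    then show ?thesis
      using f Dmap_in_Dset[OF d eval_in[OF x]] by (simp add: sConv_def convex_morphism_def)
  qed
  then show "hom_str X Y2 (Dmap (pushforward X f) d) = pushforward X f (hom_str X Y1 d)"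
    by (intro ext) (simp add: hom_str_eq[OF Dmap_in_Dset[OF d pf]] hom_str_eq[OF d],
        simp add: pushforward_def sset_comp_def compose_def hom_str_eq[OF d])
qed

lemma convex_morphism_sSet_map:
  assumes "simplicial_set X1" "g \<in> sSet X1 X2" "f \<in> sConv Y1 Y2"
  shows "convex_morphism (sSet X2 Y1) (hom_str X2 Y1) (sSet X1 Y2) (hom_str X1 Y2) (sSet_map X1 g f)"
  using convex_morphism_comp[OF convex_morphism_pullback convex_morphism_pushforward] assms
  unfolding sSet_map_def[abs_def] by blast

lemma sSet_map_id:
  assumes "\<phi> \<in> sSet X Y"
  shows "sSet_map X (sset_id X) (sset_id Y) \<phi> = \<phi>"
  using sSet_in[OF assms] sSet_outside[OF assms]
  by (intro ext) (simp add: sSet_map_def pushforward_def pullback_def sset_comp_def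
      sset_id_def compose_def)

text \<open>Extensional composites agree with plain composition only on the cells of their domain;
  the membership assumptions keep the successive values in the cells of \<open>X2\<close>,
  \<open>X3\<close> and \<open>Y1\<close>, where associativity of composition gives the
  claim.\<close>

lemma sSet_map_comp:
  assumes "g1 \<in> sSet X1 X2" "g2 \<in> sSet X2 X3" "\<phi> \<in> sSet X3 Y1"
  shows "sSet_map X1 (sset_comp X1 g2 g1) (sset_comp Y1 f2 f1) \<phi> =
    sSet_map X1 g1 f2 (sSet_map X2 g2 f1 \<phi>)"
  using assms
  by (intro ext) (simp add: sSet_map_def pushforward_def pullback_def sset_comp_def
      compose_def sSet_in)

text \<open>A functor on a product category acts on pairs of morphisms, so the functor laws are
  stated for the joint action \<open>sSet_map\<close>.\<close>

theorem proposition1p1: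
  "(\<forall>(X :: 'a sset) (Y :: ('d, 'r::{comm_semiring_0, comm_monoid_mult}) sconv).
      simplicial_set X \<and> simplicial_convex_set Y \<longrightarrow>
      convex_set (sSet X Y) (hom_str X Y)) \<and>
   (\<forall>(X1 :: 'a sset) (X2 :: 'b sset) (Y :: ('d, 'r) sconv) g.
      simplicial_set X1 \<and> simplicial_set X2 \<and> simplicial_convex_set Y \<and> g \<in> sSet X1 X2 \<longrightarrow>
      convex_morphism (sSet X2 Y) (hom_str X2 Y) (sSet X1 Y) (hom_str X1 Y) (pullback X1 g)) \<and>
   (\<forall>(X :: 'a sset) (Y1 :: ('d, 'r) sconv) (Y2 :: ('e, 'r) sconv) f.
      simplicial_set X \<and> simplicial_convex_set Y1 \<and> simplicial_convex_set Y2 \<and>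
      f \<in> sConv Y1 Y2 \<longrightarrow>
      convex_morphism (sSet X Y1) (hom_str X Y1) (sSet X Y2) (hom_str X Y2) (pushforward X f)) \<and>
   (\<forall>(X1 :: 'a sset) (X2 :: 'b sset) (Y1 :: ('d, 'r) sconv) (Y2 :: ('e, 'r) sconv) g f.
      simplicial_set X1 \<and> simplicial_set X2 \<and>
      simplicial_convex_set Y1 \<and> simplicial_convex_set Y2 \<and>
      g \<in> sSet X1 X2 \<and> f \<in> sConv Y1 Y2 \<longrightarrow>
      convex_morphism (sSet X2 Y1) (hom_str X2 Y1) (sSet X1 Y2) (hom_str X1 Y2)
        (sSet_map X1 g f)) \<and>
   (\<forall>(X :: 'a sset) (Y :: ('d, 'r) sconv) \<phi>.
      simplicial_set X \<and> simplicial_convex_set Y \<and> \<phi> \<in> sSet X Y \<longrightarrow>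
      sSet_map X (sset_id X) (sset_id Y) \<phi> = \<phi>) \<and>
   (\<forall>(X1 :: 'a sset) (X2 :: 'b sset) (X3 :: 'c sset)
      (Y1 :: ('d, 'r) sconv) (Y2 :: ('e, 'r) sconv) (Y3 :: ('f, 'r) sconv) g1 g2 f1 f2 \<phi>.
      simplicial_set X1 \<and> simplicial_set X2 \<and> simplicial_set X3 \<and>
      simplicial_convex_set Y1 \<and> simplicial_convex_set Y2 \<and> simplicial_convex_set Y3 \<and>
      g1 \<in> sSet X1 X2 \<and> g2 \<in> sSet X2 X3 \<and> f1 \<in> sConv Y1 Y2 \<and> f2 \<in> sConv Y2 Y3 \<and>
      \<phi> \<in> sSet X3 Y1 \<longrightarrow>
      sSet_map X1 (sset_comp X1 g2 g1) (sset_comp Y1 f2 f1) \<phi> =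
      sSet_map X1 g1 f2 (sSet_map X2 g2 f1 \<phi>))"
  by (intro conjI allI impI; elim conjE;
      rule convex_set_sSet convex_morphism_pullback convex_morphism_pushforward
        convex_morphism_sSet_map sSet_map_id sSet_map_comp; assumption)

end
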